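(* (Cylinder and sphere preserving.) If the initial control points and unit control normals $(\mathbf{p}_i^0,\mathbf{n}_i^0)$ are sampled from a circular cylinder or from a sphere, then all points and normals $(\mathbf{p}_i^k,\mathbf{n}_i^k)$, $k\in\mathbb{Z}_+$, generated by PN subdivision lie on the same cylinder or sphere, i.e. each $\mathbf{p}_i^k$ lies on the cylinder (respectively sphere) and $\mathbf{n}_i^k$ is the corresponding unit normal of that surface at $\mathbf{p}_i^k$.
   Context: PN (point-normal) subdivision in 3D space. Each new index $i$ at level $k+1$ has finitely many non-zero real weights $w_{ij}$ with $\sum_j w_{ij}=1$: either $w_{ij}=a_{i-2j}$, $i,j\in\mathbb{Z}^s$, $s\in\{1,2\}$, for a finitely supported mask $\{a_i\}_{i\in\mathbb{Z}^s}$ of a linear binary scheme on polygons or regular meshes, or $w_{ij}=s_{ij}$, $i,j\in\{0,\ldots,\bar l\}$, the entries of the subdivision matrix of a linear scheme on an irregular mesh around an extraordinary vertex or face. Given points $\mathbf{p}_j^k$ and unit vectors $\mathbf{n}_j^k$, $$\mathbf{q}_i^{k+1}=\sum_{j}w_{ij}\mathbf{p}_j^k,\qquad \mathbf{n}_i^{k+1}=\frac{\sum_j w_{ij}\mathbf{n}_j^k}{\left\|\sum_j w_{ij}\mathbf{n}_j^k\right\|},\qquad \mathbf{p}_i^{k+1}=\mathbf{q}_i^{k+1}+\sum_j w_{ij}h_{ij}^k\,\mathbf{n}_i^{k+1},$$ $$h_{ij}^k=\frac{(\mathbf{n}_j^k+\mathbf{n}_i^{k+1})^\top(\mathbf{p}_j^k-\mathbf{q}_i^{k+1})}{(\mathbf{n}_j^k+\mathbf{n}_i^{k+1})^\top\mathbf{n}_i^{k+1}}.$$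 It is assumed that the denominators occurring with non-zero weights do not vanish. Data are sampled from a sphere or circular cylinder when every $\mathbf{p}_i^0$ lies on the surface and $\mathbf{n}_i^0$ is the unit surface normal at $\mathbf{p}_i^0$, with a consistent orientation (all outward or all inward). *)

theory Defs
  imports "HOL-Analysis.Analysis"
begin

text \<open>
  A control net is a pair of families of points and normals over an index set \<open>I\<close>; entries
  outside \<open>I\<close> are irrelevant. All sums run over the indices with non-zero weight, which form a
  finite set for the weights considered below.
\<close>

type_synonym 'i pn_net = "('i \<Rightarrow> real^3) \<times> ('i \<Rightarrow> real^3)"

definition weight_supp :: "'i set \<Rightarrow> ('i \<Rightarrow> 'i \<Rightarrow> real) \<Rightarrow> 'i \<Rightarrow> 'i set" where
  "weight_supp I w i = {j \<in> I. w i j \<noteq> 0}"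

definition weighted_sum ::
    "'i set \<Rightarrow> ('i \<Rightarrow> 'i \<Rightarrow> real) \<Rightarrow> ('i \<Rightarrow> real^3) \<Rightarrow> 'i \<Rightarrow> real^3" where
  "weighted_sum I w v i = (\<Sum>j\<in>weight_supp I w i. w i j *\<^sub>R v j)"

definition pn_normal ::
    "'i set \<Rightarrow> ('i \<Rightarrow> 'i \<Rightarrow> real) \<Rightarrow> ('i \<Rightarrow> real^3) \<Rightarrow> 'i \<Rightarrow> real^3" where
  "pn_normal I w n i = weighted_sum I w n i /\<^sub>R norm (weighted_sum I w n i)"

definition pn_height ::
    "'i set \<Rightarrow> ('i \<Rightarrow> 'i \<Rightarrow> real) \<Rightarrow> ('i \<Rightarrow> real^3) \<Rightarrow> ('i \<Rightarrow> real^3) \<Rightarrow> 'i \<Rightarrow> 'i \<Rightarrow> real" where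
  "pn_height I w p n i j =
     ((n j + pn_normal I w n i) \<bullet> (p j - weighted_sum I w p i))
       / ((n j + pn_normal I w n i) \<bullet> pn_normal I w n i)"

definition pn_point ::
    "'i set \<Rightarrow> ('i \<Rightarrow> 'i \<Rightarrow> real) \<Rightarrow> ('i \<Rightarrow> real^3) \<Rightarrow> ('i \<Rightarrow> real^3) \<Rightarrow> 'i \<Rightarrow> real^3" where
  "pn_point I w p n i =
     weighted_sum I w p i
       + (\<Sum>j\<in>weight_supp I w i. w i j * pn_height I w p n i j) *\<^sub>R pn_normal I w n i"

primrec pn_subdivision ::
    "'i set \<Rightarrow> ('i \<Rightarrow> 'i \<Rightarrow> real) \<Rightarrow> 'i pn_net \<Rightarrow> nat \<Rightarrow> 'i pn_net" where
  "pn_subdivision I w net 0 = net"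
| "pn_subdivision I w net (Suc k) =
     (let (p, n) = pn_subdivision I w net k in (pn_point I w p n, pn_normal I w n))"

definition pn_denominators_nonzero ::
    "'i set \<Rightarrow> ('i \<Rightarrow> 'i \<Rightarrow> real) \<Rightarrow> 'i pn_net \<Rightarrow> bool" where
  "pn_denominators_nonzero I w net \<longleftrightarrow>
     (\<forall>k. \<forall>i\<in>I. let n = snd (pn_subdivision I w net k) in
        norm (weighted_sum I w n i) \<noteq> 0 \<and>
        (\<forall>j\<in>weight_supp I w i. (n j + pn_normal I w n i) \<bullet> pn_normal I w n i \<noteq> 0))"

definition affine_weights :: "'i set \<Rightarrow> ('i \<Rightarrow> 'i \<Rightarrow> real) \<Rightarrow> bool" where
  "affine_weights I w \<longleftrightarrow>
     (\<forall>i\<in>I. finite (weight_supp I w i) \<and> (\<Sum>j\<in>weight_supp I w i. w i j) = 1)"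

definition mask_weights :: "(int^'s \<Rightarrow> real) \<Rightarrow> int^'s \<Rightarrow> int^'s \<Rightarrow> real" where
  "mask_weights a i j = a (i - 2 *s j)"

text \<open>
  The component of \<open>x - c\<close> orthogonal to the unit vector \<open>d\<close>: its norm is the distance of \<open>x\<close>
  from the line through \<open>c\<close> with direction \<open>d\<close>.
\<close>

definition radial_part :: "real^3 \<Rightarrow> real^3 \<Rightarrow> real^3 \<Rightarrow> real^3" where
  "radial_part c d x = (x - c) - ((x - c) \<bullet> d) *\<^sub>R d"

definition circular_cylinder :: "real^3 \<Rightarrow> real^3 \<Rightarrow> real \<Rightarrow> (real^3) set" where
  "circular_cylinder c d r = {x. norm (radial_part c d x) = r}"

definition is_sphere :: "(real^3) set \<Rightarrow> (real^3 \<Rightarrow> real^3) \<Rightarrow> bool" where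
  "is_sphere S \<nu> \<longleftrightarrow> (\<exists>c r. r > 0 \<and> S = sphere c r \<and> \<nu> = (\<lambda>x. (x - c) /\<^sub>R r))"

definition is_circular_cylinder :: "(real^3) set \<Rightarrow> (real^3 \<Rightarrow> real^3) \<Rightarrow> bool" where
  "is_circular_cylinder S \<nu> \<longleftrightarrow>
     (\<exists>c d r. r > 0 \<and> norm d = 1 \<and> S = circular_cylinder c d r \<and>
        \<nu> = (\<lambda>x. radial_part c d x /\<^sub>R r))"

text \<open>
  Here \<open>\<nu>\<close> is the outward unit normal field of \<open>S\<close>, and the sign \<open>\<sigma>\<close>, common to all indices,
  is \<open>1\<close> for outward and \<open>- 1\<close> for inward normals.
\<close>

definition on_surface ::
    "(real^3) set \<Rightarrow> (real^3 \<Rightarrow> real^3) \<Rightarrow> real \<Rightarrow> 'i set \<Rightarrow> 'i pn_net \<Rightarrow> bool" where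
  "on_surface S \<nu> \<sigma> I net \<longleftrightarrow> (\<forall>i\<in>I. fst net i \<in> S \<and> snd net i = \<sigma> *\<^sub>R \<nu> (fst net i))"

end

(*
  With d the axis direction, let P be the orthogonal projection onto the complement of d for a
  cylinder, and P = id for a sphere. Data (p, n) are sampled from the surface iff
  P (p - c) = rho n and |n| = 1, where rho = r or rho = - r according to the orientation.
  If L is the norm of the weighted sum of the normals, then P (q - c) = rho L n', and
  (n_j + n') . (p_j - q) = rho (n_j + n') . (n_j - L n') = rho (1 - L) (1 + n_j . n'),
  so every height equals rho (1 - L) and P (p' - c) = rho n'.
*)

theory Submission imports Defs begin

text \<open>Weights of sum 1 reproduce the constant \<open>c\<close>, so the shift moves inside the
  sum, where linearity of \<open>P\<close> takes over.\<close>

lemma linear_weighted_sum_diff: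
  assumes "linear P" and "(\<Sum>j\<in>weight_supp I w i. w i j) = 1"
  shows "P (weighted_sum I w p i - c) = weighted_sum I w (\<lambda>j. P (p j - c)) i"
proof -
  have "weighted_sum I w p i - c = (\<Sum>j\<in>weight_supp I w i. w i j *\<^sub>R (p j - c))"
    using assms(2)
    by (simp add: weighted_sum_def scaleR_diff_right sum_subtractf flip: scaleR_left.sum)
  then show ?thesis
    using assms(1) by (simp add: weighted_sum_def linear_sum linear_cmul)
qed

text \<open>One refinement step at a fixed index, for both surfaces at once: \<open>adj\<close> and
  \<open>idem\<close> make the linear map \<open>P\<close> an orthogonal projection, and the sign of
  \<open>\<rho>\<close> carries the orientation.\<close>

lemma pn_step:
  assumes lin: "linear P" and adj: "\<And>x y. P x \<bullet> y = x \<bullet> P y" and idem: "\<And>x. P (P x) = P x"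
    and "\<rho> \<noteq> 0"
    and sum1: "(\<Sum>j\<in>weight_supp I w i. w i j) = 1"
    and L0: "norm (weighted_sum I w n i) \<noteq> 0"
    and den: "\<And>j. j \<in> weight_supp I w i \<Longrightarrow> (n j + pn_normal I w n i) \<bullet> pn_normal I w n i \<noteq> 0"
    and pn: "\<And>j. j \<in> I \<Longrightarrow> P (p j - c) = \<rho> *\<^sub>R n j" and unit: "\<And>j. j \<in> I \<Longrightarrow> norm (n j) = 1"
  shows "norm (pn_normal I w n i) = 1"
    and "P (pn_point I w p n i - c) = \<rho> *\<^sub>R pn_normal I w n i"
proof -
  define n' where "n' = pn_normal I w n i"
  define q where "q = weighted_sum I w p i"
  define L where "L = norm (weighted_sum I w n i)"
  show n'_unit: "norm (pn_normal I w n i) = 1"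
    using L0 by (simp add: pn_normal_def)
  have sum_n: "weighted_sum I w n i = L *\<^sub>R n'"
    using L0 by (simp add: n'_def L_def pn_normal_def)
  \<comment> \<open>A nonzero multiple of \<open>n j\<close> is a value of \<open>P\<close>, and an
    idempotent map fixes its values.\<close>
  have Pn: "P (n j) = n j" if "j \<in> I" for j
  proof -
    have "\<rho> *\<^sub>R P (n j) = P (P (p j - c))"
      using pn[OF that] lin by (simp add: linear_cmul)
    also have "\<dots> = \<rho> *\<^sub>R n j"
      using idem[of "p j - c"] unfolding pn[OF that] .
    finally show ?thesis
      using \<open>\<rho> \<noteq> 0\<close> by simp
  qed
  \<comment> \<open>The choice \<open>c = 0\<close> says that \<open>P\<close> commutes with the
    weighted sum.\<close>
  have Psum: "P (weighted_sum I w n i) = weighted_sum I w n i"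
    using Pn linear_weighted_sum_diff[OF lin sum1, of n 0]
    by (simp add: weighted_sum_def weight_supp_def)
  have Pn': "P n' = n'"
    using Psum lin by (simp add: n'_def pn_normal_def linear_cmul)
  have Pq: "P (q - c) = (\<rho> * L) *\<^sub>R n'"
  proof -
    have "P (q - c) = \<rho> *\<^sub>R weighted_sum I w n i"
      unfolding q_def linear_weighted_sum_diff[OF lin sum1]
      by (auto simp: weighted_sum_def weight_supp_def pn scaleR_sum_right mult.commute intro!: sum.cong)
    then show ?thesis using sum_n by simp
  qed
  have height: "pn_height I w p n i j = \<rho> * (1 - L)" if j: "j \<in> weight_supp I w i" for j
  proof -
    have jI: "j \<in> I" using j by (simp add: weight_supp_def)
    have nn: "n j \<bullet> n j = 1" "n' \<bullet> n' = 1"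
      using unit[OF jI] n'_unit by (simp_all add: n'_def norm_eq_1)
    have "P (p j - q) = P (p j - c) - P (q - c)"
      using lin by (simp flip: linear_diff)
    also have "\<dots> = \<rho> *\<^sub>R (n j - L *\<^sub>R n')"
      using pn[OF jI] Pq by (simp add: scaleR_diff_right)
    finally have Ppq: "P (p j - q) = \<rho> *\<^sub>R (n j - L *\<^sub>R n')" .
    \<comment> \<open>\<open>P\<close> fixes both normals and is self-adjoint, so it can be moved
      onto \<open>p j - q\<close>; for a cylinder this discards the axial component.\<close>
    have "(n j + n') \<bullet> (p j - q) = P (n j + n') \<bullet> (p j - q)"
      using lin Pn[OF jI] Pn' by (simp add: linear_add)
    also have "\<dots> = \<rho> * ((n j + n') \<bullet> (n j - L *\<^sub>R n'))"
      by (simp add: adj Ppq)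
    \<comment> \<open>The last factor is exactly the denominator of the height, which
      \<open>den\<close> allows to cancel.\<close>
    also have "\<dots> = \<rho> * (1 - L) * ((n j + n') \<bullet> n')"
      using nn by (simp add: inner_simps inner_commute algebra_simps)
    finally show ?thesis
      using den[OF j] by (simp add: pn_height_def flip: n'_def q_def)
  qed
  \<comment> \<open>The heights do not depend on \<open>j\<close>, so averaging them with weights of
    sum 1 returns their common value.\<close>
  have "pn_point I w p n i = q + (\<rho> * (1 - L)) *\<^sub>R n'"
    using height sum1 by (simp add: pn_point_def flip: n'_def q_def sum_distrib_right)
  then have "P (pn_point I w p n i - c) = P ((q - c) + (\<rho> * (1 - L)) *\<^sub>R n')"
    by (simp only: diff_add_eq)
  also have "\<dots> = \<rho> *\<^sub>R n'"
    unfolding linear_add[OF lin] linear_cmul[OF lin] Pq Pn' by (simp add: algebra_simps)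
  finally show "P (pn_point I w p n i - c) = \<rho> *\<^sub>R pn_normal I w n i"
    by (simp add: n'_def)
qed

lemma surface_projection:
  assumes "is_circular_cylinder S \<nu> \<or> is_sphere S \<nu>"
  obtains P r c where "linear P" "\<And>x y. P x \<bullet> y = x \<bullet> P y" "\<And>x. P (P x) = P x" "r > 0"
    "S = {x. norm (P (x - c)) = r}" "\<nu> = (\<lambda>x. P (x - c) /\<^sub>R r)"
  using assms
proof
  assume "is_circular_cylinder S \<nu>"
  then obtain c d r where r: "r > 0" and d: "norm d = 1" and S: "S = circular_cylinder c d r"
    and \<nu>: "\<nu> = (\<lambda>x. radial_part c d x /\<^sub>R r)"
    unfolding is_circular_cylinder_def by blast
  show thesis
  \<comment> \<open>Base point 0 gives the linear part of the affine map
    \<open>radial_part c d\<close>; applied to \<open>x - c\<close> it recovers that map.\<close>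
  proof (rule that[of "radial_part 0 d" r c])
    show "linear (radial_part 0 d)"
      by (rule linearI) (simp_all add: radial_part_def inner_simps algebra_simps)
    show "radial_part 0 d x \<bullet> y = x \<bullet> radial_part 0 d y" for x y
      by (simp add: radial_part_def inner_simps inner_commute)
    show "radial_part 0 d (radial_part 0 d x) = radial_part 0 d x" for x
      using d by (simp add: radial_part_def inner_simps norm_eq_1)
  qed (use r S \<nu> in \<open>simp_all add: circular_cylinder_def radial_part_def\<close>)
next
  assume "is_sphere S \<nu>"
  then obtain c r where "r > 0" "S = sphere c r" "\<nu> = (\<lambda>x. (x - c) /\<^sub>R r)"
    unfolding is_sphere_def by blast
  then show thesis
    by (intro that[of "\<lambda>x. x" r c]) (auto simp: linear_id[unfolded id_def] dist_norm norm_minus_commute)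
qed

text \<open>Because \<open>\<sigma>\<close> is its own inverse and \<open>r > 0\<close>, the normal
  condition can be solved for the point. The resulting relation is linear in points and normals, the
  form in which \<open>pn_step\<close> propagates it with
  \<open>\<rho> = \<sigma> * r\<close>.\<close>

lemma on_surface_iff_projection:
  assumes "r > 0" and "\<sigma> = 1 \<or> \<sigma> = - 1"
  shows "on_surface {x. norm (P (x - c)) = r} (\<lambda>x. P (x - c) /\<^sub>R r) \<sigma> I (p, n) \<longleftrightarrow>
    (\<forall>i\<in>I. P (p i - c) = (\<sigma> * r) *\<^sub>R n i \<and> norm (n i) = 1)"
proof -
  have "norm x = r \<and> y = \<sigma> *\<^sub>R (x /\<^sub>R r) \<longleftrightarrow> x = (\<sigma> * r) *\<^sub>R y \<and> norm y = 1" for x y :: "real^3"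
    using assms by auto
  then show ?thesis
    by (simp add: on_surface_def)
qed

text \<open>Stated for any index set with affine weights, so that masks and subdivision matrices are
  two instances. The proof is by induction on the level, with \<open>pn_step\<close> applied at each
  index.\<close>

theorem pn_subdivision_on_surface:
  assumes "is_circular_cylinder S \<nu> \<or> is_sphere S \<nu>" and \<sigma>: "\<sigma> = 1 \<or> \<sigma> = - 1"
    and aff: "affine_weights I w" and den: "pn_denominators_nonzero I w net"
    and init: "on_surface S \<nu> \<sigma> I net"
  shows "on_surface S \<nu> \<sigma> I (pn_subdivision I w net k)"
proof (induction k)
  case 0
  show ?case using init by simp
next
  case (Suc k)
  obtain P r c where P: "linear P" "\<And>x y. P x \<bullet> y = x \<bullet> P y" "\<And>x. P (P x) = P x"
    and r: "r > 0" and S: "S = {x. norm (P (x - c)) = r}" and \<nu>: "\<nu> = (\<lambda>x. P (x - c) /\<^sub>R r)"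
    by (rule surface_projection[OF assms(1)], erule that) simp_all
  obtain p n where net_k: "pn_subdivision I w net k = (p, n)"
    by fastforce
  \<comment> \<open>Folding restores \<open>S\<close> and \<open>\<nu>\<close>, so the equivalence
    rewrites both the induction hypothesis and the goal.\<close>
  note surface_iff = on_surface_iff_projection[OF r \<sigma>, of P c I, folded S \<nu>]
  have IH: "P (p j - c) = (\<sigma> * r) *\<^sub>R n j" "norm (n j) = 1" if "j \<in> I" for j
    using Suc.IH that by (auto simp: net_k surface_iff)
  have \<rho>: "\<sigma> * r \<noteq> 0"
    using r \<sigma> by auto
  have "norm (pn_normal I w n i) = 1 \<and>
      P (pn_point I w p n i - c) = (\<sigma> * r) *\<^sub>R pn_normal I w n i" if i: "i \<in> I" for i
  proof -
    have sum1: "(\<Sum>j\<in>weight_supp I w i. w i j) = 1"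
      using aff i by (simp add: affine_weights_def)
    have "norm (weighted_sum I w n i) \<noteq> 0"
      and "\<forall>j\<in>weight_supp I w i. (n j + pn_normal I w n i) \<bullet> pn_normal I w n i \<noteq> 0"
      using den[unfolded pn_denominators_nonzero_def Let_def, THEN spec, of k] i
      unfolding net_k snd_conv by blast+
    with pn_step[OF P \<rho> sum1 _ _ IH] show ?thesis by simp
  qed
  then show ?case
    by (simp add: net_k surface_iff)
qed

theorem mainTheorem2:
  fixes S :: "(real^3) set" and \<nu> :: "real^3 \<Rightarrow> real^3" and \<sigma> :: real
    and a :: "int^'s \<Rightarrow> real" and net :: "(int^'s) pn_net"
    and l :: nat and s :: "nat \<Rightarrow> nat \<Rightarrow> real" and net' :: "nat pn_net"
  assumes "is_circular_cylinder S \<nu> \<or> is_sphere S \<nu>"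
    and "\<sigma> = 1 \<or> \<sigma> = - 1"
  shows "(CARD('s) \<in> {1, 2} \<and> finite {i. a i \<noteq> 0} \<and>
          affine_weights UNIV (mask_weights a) \<and>
          pn_denominators_nonzero UNIV (mask_weights a) net \<and>
          on_surface S \<nu> \<sigma> UNIV net
            \<longrightarrow> (\<forall>k. on_surface S \<nu> \<sigma> UNIV (pn_subdivision UNIV (mask_weights a) net k)))
       \<and> (affine_weights {0..l} s \<and>
          pn_denominators_nonzero {0..l} s net' \<and>
          on_surface S \<nu> \<sigma> {0..l} net'
            \<longrightarrow> (\<forall>k. on_surface S \<nu> \<sigma> {0..l} (pn_subdivision {0..l} s net' k)))"
  by (intro conjI impI allI) (simp_all add: pn_subdivision_on_surface[OF assms])

end
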